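(* For $0<|z|\le 1$ (with $\arg z\in(-\pi,\pi]$): (1) $f_k(z)\le f_k(|z|)\le f_2(|z|)<f_1(z)$ for all $k\ge2$ when $|\arg z|\le\pi/3$; (2) $f_k(z)\le f_k(|z|)<f_1(z)$ for all $k\ge3$ when $|\arg z|\le\pi/2$; (3) $f_k(z)<f_1(z)$ for all $k\ge2$ when $0\le\arg z\le\pi/2$; (4) $f_k(z)<\max[f_1(z),f_2(z),f_3(z)]$ for all $k\ge4$ when $\pi/2\le\arg z\le\pi$.
   Context: $\mathrm{Li}_2(z)=\sum_{n\ge1}z^n/n^2$ for $|z|\le1$. For a positive integer $k$, the root dilogarithm is $f_k(z)=\frac1k\Re\big[\sqrt{\mathrm{Li}_2(z^k)}\big]$, where the square root is the principal branch (nonnegative real part). *)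

theory Defs
  imports "HOL-Analysis.Analysis"
begin

(* The series converges only for cmod z <= 1; the value outside the closed unit disc is
   unspecified and not meant to be used. *)
definition Li2 :: "complex \<Rightarrow> complex" where
  "Li2 z = (\<Sum>n. z ^ Suc n / of_nat (Suc n) ^ 2)"

definition root_dilog :: "nat \<Rightarrow> complex \<Rightarrow> real" where
  "root_dilog k z = (1 / real k) * Re (csqrt (Li2 (z ^ k)))"

end

theory Submission
  imports Defs
begin

text \<open>
  With \<open>S(z) = |Li\<^sub>2(z)| + Re Li\<^sub>2(z)\<close> one has \<open>f\<^sub>k(z)\<^sup>2 = S(z^k) / (2k\<^sup>2)\<close>, so everything reduces
  to bounds for \<open>S\<close>. From above, \<open>S(z) \<le> 2 Li\<^sub>2(|z|) \<le> 3.3 |z|\<close>, and half of that when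
  \<open>Re z \<le> 0\<close>. From below, \<open>S\<close> dominates the linear functionals \<open>Re Li\<^sub>2 + Im Li\<^sub>2\<close> and
  \<open>(Re Li\<^sub>2 + 3 Im Li\<^sub>2) / 5\<close>. Such a functional at \<open>r w\<close>, \<open>|w| = 1\<close>, is \<open>r\<close> times the mean of a
  rational kernel in \<open>v = r u\<close> with respect to the density \<open>- ln u\<close> on \<open>[0, 1]\<close>, whose first
  moment is \<open>1/4\<close>; a linear minorant \<open>p + q v\<close> of the kernel thus gives the lower bound
  \<open>r (p + q r / 4)\<close>. One such minorant for each of the sectors ending at \<open>\<pi>/3\<close>, \<open>\<pi>/2\<close>, \<open>2\<pi>/3\<close>,
  \<open>3\<pi>/4\<close> suffices. For arguments beyond \<open>3\<pi>/4\<close> one compares with \<open>f\<^sub>2\<close>, applying the bounds to \<open>z\<^sup>2\<close>;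
  between \<open>2\<pi>/3\<close> and \<open>5\<pi>/6\<close> the case \<open>k = 4\<close> uses \<open>Re z^4 \<le> 0\<close>.
\<close>

section \<open>Weighted series and positivity of the double integration\<close>

lemma summable_over_Suc_squared:
  fixes a :: "nat \<Rightarrow> 'a :: {real_normed_field, banach}"
  assumes "\<And>n. norm (a n) \<le> M"
  shows "summable (\<lambda>n. a n / of_nat (Suc n) ^ 2)"
proof (rule summable_comparison_test')
  have "summable (\<lambda>n. 1 / (real n + 1) ^ 2)"
    using inverse_squares_sums by (simp add: sums_iff add.commute)
  then show "summable (\<lambda>n. M * (1 / (real n + 1) ^ 2))"
    by (rule summable_mult)
  show "norm (a n / of_nat (Suc n) ^ 2) \<le> M * (1 / (real n + 1) ^ 2)" for n
  proof -
    have "norm (of_nat (Suc n) :: 'a) = real (Suc n)"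
      by (rule norm_of_nat)
    then show ?thesis
      using assms[of n]
      by (simp add: norm_divide norm_power divide_right_mono add.commute del: of_nat_Suc)
         (simp add: divide_right_mono)
  qed
qed

lemma summable_bounded_power:
  fixes a :: "nat \<Rightarrow> real"
  assumes "\<And>n. \<bar>a n\<bar> \<le> M" and "\<bar>v\<bar> < 1"
  shows "summable (\<lambda>n. a n * v ^ n)"
proof (rule summable_comparison_test')
  show "summable (\<lambda>n. M * \<bar>v\<bar> ^ n)"
    using assms(2) by (intro summable_mult summable_geometric) auto
  show "norm (a n * v ^ n) \<le> M * \<bar>v\<bar> ^ n" for n
    using assms(1)[of n] by (simp add: abs_mult power_abs mult_right_mono)
qed

text \<open>The double integration \<open>\<Sum> a\<^sub>n v^n \<mapsto> \<Sum> a\<^sub>n r^(n+1) / (n+1)\<^sup>2\<close> is a positive operator.\<close>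
lemma dilog_transform_nonneg:
  fixes a :: "nat \<Rightarrow> real"
  assumes bounded: "\<And>n. \<bar>a n\<bar> \<le> M"
    and nonneg: "\<And>v. 0 \<le> v \<Longrightarrow> v < 1 \<Longrightarrow> 0 \<le> (\<Sum>n. a n * v ^ n)"
    and r: "0 \<le> r" "r \<le> 1"
  shows "0 \<le> (\<Sum>n. a n * r ^ Suc n / real (Suc n) ^ 2)"
proof -
  have M: "0 \<le> M" using bounded[of 0] by linarith
  have bounded': "\<bar>a n / real (Suc n)\<bar> \<le> M" for n
  proof -
    have "\<bar>a n\<bar> / real (Suc n) \<le> \<bar>a n\<bar> / 1" by (rule divide_left_mono) auto
    then show ?thesis using bounded[of n] by (simp add: abs_divide)
  qed
  \<comment> \<open>For \<open>\<bar>x\<bar> < 1\<close>, \<open>F1\<close> has derivative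
    \<open>\<Sum>n. a n * x ^ n\<close> and \<open>x\<close> times the derivative of
    \<open>F2\<close> is \<open>F1\<close>, so nonnegativity passes up through two antiderivatives
    that vanish at 0.\<close>
  define F1 where "F1 x = (\<Sum>n. a n / real (Suc n) * x ^ Suc n)" for x
  define F2 where "F2 x = (\<Sum>n. a n / real (Suc n) ^ 2 * x ^ Suc n)" for x
  have D1: "(F1 has_real_derivative (\<Sum>n. a n * x ^ n)) (at x)" if "\<bar>x\<bar> < 1" for x
    using DERIV_power_series'[of 1 "\<lambda>n. a n / real (Suc n)" x] that
      summable_bounded_power[OF bounded] unfolding F1_def by (simp add: abs_less_iff)
  have D2: "(F2 has_real_derivative (\<Sum>n. a n / real (Suc n) * x ^ n)) (at x)" if "\<bar>x\<bar> < 1" for x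
  proof -
    have eq: "a n / real (Suc n) ^ 2 * real (Suc n) = a n / real (Suc n)" for n
      by (simp add: power2_eq_square)
    show ?thesis
      using DERIV_power_series'[of 1 "\<lambda>n. a n / real (Suc n) ^ 2" x] that
        summable_bounded_power[OF bounded'] unfolding F2_def eq by (simp add: abs_less_iff)
  qed
  have F1_nonneg: "0 \<le> F1 x" if "0 \<le> x" "x < 1" for x
  proof -
    have "F1 0 \<le> F1 x"
      using that D1 nonneg by (intro DERIV_nonneg_imp_nondecreasing[OF that(1)]) force
    then show ?thesis by (simp add: F1_def)
  qed
  have dF2_nonneg: "0 \<le> (\<Sum>n. a n / real (Suc n) * x ^ n)" if "0 < x" "x < 1" for x
  proof -
    have "summable (\<lambda>n. a n / real (Suc n) * x ^ n)"
      using that by (intro summable_bounded_power[OF bounded']) auto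
    from suminf_mult[OF this, of x] have "F1 x = x * (\<Sum>n. a n / real (Suc n) * x ^ n)"
      unfolding F1_def by (simp add: mult_ac)
    then show ?thesis using F1_nonneg[of x] that by (simp add: zero_le_mult_iff)
  qed
  \<comment> \<open>Termwise differentiation works only inside the unit disc, while
    \<open>r = 1\<close> is allowed; continuity of \<open>F2\<close> up to \<open>r\<close> closes
    the gap.\<close>
  have "uniform_limit {0..r} (\<lambda>n x. \<Sum>i<n. a i / real (Suc i) ^ 2 * x ^ Suc i)
          (\<lambda>x. \<Sum>i. a i / real (Suc i) ^ 2 * x ^ Suc i) sequentially"
  proof (rule Weierstrass_m_test)
    show "summable (\<lambda>n. M / real (Suc n) ^ 2)"
      using summable_over_Suc_squared[of "\<lambda>_. M" M] M by simp
    show "norm (a n / real (Suc n) ^ 2 * x ^ Suc n) \<le> M / real (Suc n) ^ 2"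
      if "x \<in> {0..r}" for n x
    proof -
      have "\<bar>a n\<bar> * x ^ Suc n \<le> M * 1"
        using bounded[of n] that r M by (intro mult_mono power_le_one) auto
      then show ?thesis
        using that by (simp add: abs_mult divide_right_mono del: power_Suc of_nat_Suc)
    qed
  qed
  then have "continuous_on {0..r} F2"
    unfolding F2_def
    by (rule uniform_limit_theorem[rotated]) (auto intro!: always_eventually continuous_intros)
  then have "F2 0 \<le> F2 r"
    using r D2 dF2_nonneg by (intro DERIV_nonneg_imp_increasing_open[OF r(1)]) force+
  then show ?thesis by (simp add: F2_def)
qed

section \<open>The dilogarithm series and lower bounds for linear functionals of it\<close>

lemma Li2_sums:
  assumes "cmod z \<le> 1"
  shows "(\<lambda>n. z ^ Suc n / of_nat (Suc n) ^ 2) sums Li2 z"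
  unfolding Li2_def
  by (rule summable_sums, rule summable_over_Suc_squared[where M = 1])
     (use assms in \<open>simp add: norm_power power_le_one del: power_Suc\<close>)

lemma Re_Im_divide_Suc_squared:
  "Re (z / of_nat (Suc n) ^ 2) = Re z / real (Suc n) ^ 2"
  "Im (z / of_nat (Suc n) ^ 2) = Im z / real (Suc n) ^ 2"
proof -
  have "(of_nat (Suc n) :: complex) ^ 2 = of_real (real (Suc n) ^ 2)" by simp
  then show "Re (z / of_nat (Suc n) ^ 2) = Re z / real (Suc n) ^ 2"
    "Im (z / of_nat (Suc n) ^ 2) = Im z / real (Suc n) ^ 2"
    by (simp_all only: Re_divide_of_real Im_divide_of_real)
qed

text \<open>The hypothesis says that the kernel \<open>\<alpha> Re (w / (1 - v w)) + \<beta> Im (w / (1 - v w))\<close>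
  is at least \<open>p + q v\<close>.\<close>
lemma Li2_linear_functional_ge:
  assumes w: "cmod w = 1" and r: "0 \<le> r" "r \<le> 1"
    and kernel: "\<And>v. 0 \<le> v \<Longrightarrow> v < 1 \<Longrightarrow>
      (p + q * v) * (1 - 2 * v * Re w + v\<^sup>2) \<le> \<alpha> * (Re w - v) + \<beta> * Im w"
  shows "r * (p + q * r / 4) \<le> \<alpha> * Re (Li2 (of_real r * w)) + \<beta> * Im (Li2 (of_real r * w))"
proof -
  \<comment> \<open>\<open>l\<close> lists the coefficients of the minorant
    \<open>p + q * v\<close>, and \<open>a\<close> those of the kernel minus the minorant.\<close>
  define l where "l n = (if n = 0 then p else if n = 1 then q else 0)" for n :: nat
  define a where "a n = \<alpha> * Re (w ^ Suc n) + \<beta> * Im (w ^ Suc n) - l n" for n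
  have l_sums: "(\<lambda>n. l n * f n) sums (p * f 0 + q * f 1)" for f :: "nat \<Rightarrow> real"
    using sums_finite[of "{0, 1}" "\<lambda>n. l n * f n"] by (simp add: l_def)
  have "\<bar>a n\<bar> \<le> \<bar>\<alpha>\<bar> + \<bar>\<beta>\<bar> + (\<bar>p\<bar> + \<bar>q\<bar>)" for n
  proof -
    have n1: "cmod (w ^ Suc n) = 1" by (simp only: norm_power w power_one)
    have "\<bar>\<alpha> * Re (w ^ Suc n)\<bar> \<le> \<bar>\<alpha>\<bar> * 1"
      unfolding abs_mult using abs_Re_le_cmod[of "w ^ Suc n"] n1 by (intro mult_left_mono) auto
    moreover have "\<bar>\<beta> * Im (w ^ Suc n)\<bar> \<le> \<bar>\<beta>\<bar> * 1"
      unfolding abs_mult using abs_Im_le_cmod[of "w ^ Suc n"] n1 by (intro mult_left_mono) auto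
    moreover have "\<bar>l n\<bar> \<le> \<bar>p\<bar> + \<bar>q\<bar>" by (simp add: l_def)
    ultimately show ?thesis unfolding a_def by linarith
  qed
  moreover have "0 \<le> (\<Sum>n. a n * v ^ n)" if v: "0 \<le> v" "v < 1" for v
  proof -
    \<comment> \<open>\<open>D\<close> is the squared modulus of \<open>1 - v * w\<close>, the
      denominator produced by summing the geometric series.\<close>
    define D where "D = 1 - 2 * v * Re w + v\<^sup>2"
    have ww: "Re w ^ 2 + Im w ^ 2 = 1" using w cmod_power2[of w] by simp
    have D: "D = (1 - v * Re w)\<^sup>2 + (v * Im w)\<^sup>2"
      unfolding D_def using ww by algebra
    have nlt: "cmod (w * of_real v) < 1" using v w by (simp add: norm_mult)
    have "Re w \<le> 1" using complex_Re_le_cmod[of w] w by simp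
    then have "v * Re w \<le> v" using v mult_left_mono[of "Re w" 1 v] by simp
    then have "0 < 1 - v * Re w" using v by linarith
    then have Dpos: "0 < D" unfolding D by (intro add_pos_nonneg) auto
    have "(\<lambda>n. w * (w * of_real v) ^ n) sums (w * (1 / (1 - w * of_real v)))"
      using nlt by (intro sums_mult geometric_sums)
    moreover have "w * (w * of_real v) ^ n = of_real (v ^ n) * w ^ Suc n" for n
      by (simp add: power_mult_distrib mult_ac)
    moreover have "w * (1 / (1 - w * of_real v)) = Complex ((Re w - v) / D) (Im w / D)"
    proof -
      have ne: "1 - w * of_real v \<noteq> 0" using nlt by auto
      have "Complex ((Re w - v) / D) (Im w / D) * (1 - w * of_real v) = w"
      proof (rule complex_eqI)
        show "Re (Complex ((Re w - v) / D) (Im w / D) * (1 - w * of_real v)) = Re w"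
        proof -
          have "(Re w - v) * (1 - Re w * v) + Im w * (Im w * v) = Re w * D"
            unfolding D_def using ww by algebra
          moreover have "Re (Complex ((Re w - v) / D) (Im w / D) * (1 - w * of_real v))
              = ((Re w - v) * (1 - Re w * v) + Im w * (Im w * v)) / D"
            by (simp add: add_divide_distrib)
          ultimately show ?thesis using Dpos by simp
        qed
        show "Im (Complex ((Re w - v) / D) (Im w / D) * (1 - w * of_real v)) = Im w"
        proof -
          have "- (Re w - v) * (Im w * v) + Im w * (1 - Re w * v) = Im w * D"
            unfolding D_def by algebra
          moreover have "Im (Complex ((Re w - v) / D) (Im w / D) * (1 - w * of_real v))
              = (- (Re w - v) * (Im w * v) + Im w * (1 - Re w * v)) / D"
            by (simp add: add_divide_distrib diff_divide_distrib algebra_simps)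
          ultimately show ?thesis using Dpos by simp
        qed
      qed
      then show ?thesis using ne by (simp add: field_simps)
    qed
    ultimately have S: "(\<lambda>n. of_real (v ^ n) * w ^ Suc n) sums Complex ((Re w - v) / D) (Im w / D)"
      by simp
    have "(\<lambda>n. \<alpha> * Re (of_real (v ^ n) * w ^ Suc n) + \<beta> * Im (of_real (v ^ n) * w ^ Suc n)
             - l n * v ^ n) sums (\<alpha> * ((Re w - v) / D) + \<beta> * (Im w / D) - (p * v ^ 0 + q * v ^ 1))"
      using sums_Re[OF S] sums_Im[OF S]
      by (intro sums_diff sums_add sums_mult l_sums) (simp_all only: complex.sel)
    moreover have "\<alpha> * Re (of_real (v ^ n) * w ^ Suc n) + \<beta> * Im (of_real (v ^ n) * w ^ Suc n)
             - l n * v ^ n = a n * v ^ n" for n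
      unfolding Re_complex_of_real Im_complex_of_real times_complex.sel a_def
      by (simp add: algebra_simps del: power_Suc of_real_power)
    ultimately have "(\<Sum>n. a n * v ^ n) = \<alpha> * ((Re w - v) / D) + \<beta> * (Im w / D) - (p + q * v)"
      by (simp add: sums_iff)
    also have "\<dots> = (\<alpha> * (Re w - v) + \<beta> * Im w - (p + q * v) * D) / D"
      using Dpos by (simp add: field_simps)
    also have "\<dots> \<ge> 0" using kernel[OF v] Dpos by (simp add: D_def)
    finally show ?thesis .
  qed
  ultimately have nonneg: "0 \<le> (\<Sum>n. a n * r ^ Suc n / real (Suc n) ^ 2)"
    using dilog_transform_nonneg[of a] r by blast
  let ?z = "of_real r * w"
  have L: "(\<lambda>n. ?z ^ Suc n / of_nat (Suc n) ^ 2) sums Li2 ?z"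
    using r w by (intro Li2_sums) (simp add: norm_mult)
  \<comment> \<open>The term with \<open>n = 1\<close> carries the weight 1/4, which is the origin
    of \<open>q * r / 4\<close>.\<close>
  have "(\<lambda>n. \<alpha> * Re (?z ^ Suc n / of_nat (Suc n) ^ 2) + \<beta> * Im (?z ^ Suc n / of_nat (Suc n) ^ 2)
           - l n * (r ^ Suc n / real (Suc n) ^ 2))
        sums (\<alpha> * Re (Li2 ?z) + \<beta> * Im (Li2 ?z)
           - (p * (r ^ Suc 0 / real (Suc 0) ^ 2) + q * (r ^ Suc 1 / real (Suc 1) ^ 2)))"
    by (intro sums_diff sums_add sums_mult l_sums sums_Re[OF L] sums_Im[OF L])
  moreover have "\<alpha> * Re (?z ^ Suc n / of_nat (Suc n) ^ 2) + \<beta> * Im (?z ^ Suc n / of_nat (Suc n) ^ 2)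
           - l n * (r ^ Suc n / real (Suc n) ^ 2) = a n * r ^ Suc n / real (Suc n) ^ 2" for n
  proof -
    have "?z ^ Suc n = of_real (r ^ Suc n) * w ^ Suc n"
      by (simp only: power_mult_distrib of_real_power)
    then have "Re (?z ^ Suc n) = r ^ Suc n * Re (w ^ Suc n)" "Im (?z ^ Suc n) = r ^ Suc n * Im (w ^ Suc n)"
      by (simp_all only: Re_complex_of_real Im_complex_of_real times_complex.sel mult_zero_left diff_zero add_0_right)
    then show ?thesis
      unfolding Re_Im_divide_Suc_squared a_def
      by (simp add: algebra_simps diff_divide_distrib add_divide_distrib del: power_Suc of_nat_Suc)
  qed
  ultimately have "(\<Sum>n. a n * r ^ Suc n / real (Suc n) ^ 2)
      = \<alpha> * Re (Li2 ?z) + \<beta> * Im (Li2 ?z) - r * (p + q * r / 4)"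
    by (simp add: sums_iff power2_eq_square algebra_simps del: of_real_mult)
  then show ?thesis using nonneg by linarith
qed

section \<open>Upper bounds for the dilogarithm on the disc\<close>

lemma Re_Li2_of_real_sums:
  assumes "0 \<le> s" "s \<le> 1"
  shows "(\<lambda>n. s ^ Suc n / real (Suc n) ^ 2) sums Re (Li2 (of_real s))"
proof -
  have "(\<lambda>n. complex_of_real s ^ Suc n / of_nat (Suc n) ^ 2) sums Li2 (of_real s)"
    using assms by (intro Li2_sums) simp
  from sums_Re[OF this] show ?thesis
    unfolding Re_Im_divide_Suc_squared of_real_power[symmetric] Re_complex_of_real .
qed

text \<open>Termwise triangle inequality. A free radius \<open>s\<close> allows powers of different
  exponents to be compared at one point.\<close>

lemma norm_Li2_le_of_cmod_le:
  assumes "cmod z \<le> s" "s \<le> 1"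
  shows "cmod (Li2 z) \<le> Re (Li2 (of_real s))"
proof -
  have s: "0 \<le> s" using assms norm_ge_zero order_trans by blast
  note R = Re_Li2_of_real_sums[OF s assms(2)]
  have "norm (z ^ Suc n / of_nat (Suc n) ^ 2) \<le> s ^ Suc n / real (Suc n) ^ 2" for n
  proof -
    have "norm (of_nat (Suc n) :: complex) = real (Suc n)" by (rule norm_of_nat)
    then show ?thesis
      using assms by (simp add: norm_divide norm_power power_mono divide_right_mono del: power_Suc of_nat_Suc)
  qed
  from norm_suminf_le[OF this sums_summable[OF R]] show ?thesis
    using R by (simp only: Li2_def[of z] sums_iff)
qed

text \<open>Each power of \<open>s\<close> is at most \<open>s\<close>, and the remaining sum pi^2/6
  = 1.6449... lies just below 33/20.\<close>

lemma Re_Li2_of_real_le: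
  assumes "0 \<le> s" "s \<le> 1"
  shows "Re (Li2 (of_real s)) \<le> 33 / 20 * s"
proof -
  have "(\<lambda>n. s * (1 / real (Suc n) ^ 2)) sums (s * (pi\<^sup>2 / 6))"
    using inverse_squares_sums by (intro sums_mult) (simp add: add.commute)
  then have "Re (Li2 (of_real s)) \<le> s * (pi\<^sup>2 / 6)"
    by (rule sums_le[OF _ Re_Li2_of_real_sums[OF assms], rotated])
      (use assms in \<open>auto simp: divide_right_mono mult_left_le power_le_one\<close>)
  also have "pi\<^sup>2 \<le> (3.1416)\<^sup>2" using pi_approx by (intro power_mono) auto
  then have "s * (pi\<^sup>2 / 6) \<le> s * (33 / 20)"
    using assms by (intro mult_left_mono) (auto simp: power2_eq_square)
  finally show ?thesis by simp
qed

section \<open>The weight under the square root and its upper bounds\<close>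

text \<open>This is twice the square of \<open>Re (csqrt (Li2 z))\<close>; working with it avoids
  all square roots.\<close>

definition dilog_weight :: "complex \<Rightarrow> real" where
  "dilog_weight z = cmod (Li2 z) + Re (Li2 z)"

lemma dilog_weight_nonneg: "0 \<le> dilog_weight z"
  using abs_Re_le_cmod[of "Li2 z"] by (simp add: dilog_weight_def)

text \<open>Half-angle formula for the principal square root: its real part at u is sqrt ((|u| + Re
  u) / 2).\<close>

lemma root_dilog_eq: "root_dilog k z = sqrt (dilog_weight (z ^ k) / (2 * real k ^ 2))"
  by (simp add: root_dilog_def dilog_weight_def real_sqrt_divide real_sqrt_mult)

lemma dilog_weight_cnj:
  assumes "cmod z \<le> 1"
  shows "dilog_weight (cnj z) = dilog_weight z"
proof -
  have "(\<lambda>n. cnj z ^ Suc n / of_nat (Suc n) ^ 2) sums cnj (Li2 z)"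
    using sums_cnj[THEN iffD2, OF Li2_sums[OF assms]]
    by (simp only: complex_cnj_divide complex_cnj_power complex_cnj_of_nat)
  then have "Li2 (cnj z) = cnj (Li2 z)"
    unfolding Li2_def[of "cnj z"] by (simp only: sums_iff)
  then show ?thesis by (simp add: dilog_weight_def)
qed

lemma dilog_weight_le:
  assumes "cmod z \<le> s" "s \<le> 1"
  shows "dilog_weight z \<le> 2 * Re (Li2 (of_real s))"
  using norm_Li2_le_of_cmod_le[OF assms] complex_Re_le_cmod[of "Li2 z"]
  by (simp add: dilog_weight_def)

lemma dilog_weight_of_real:
  assumes "0 \<le> s" "s \<le> 1"
  shows "dilog_weight (of_real s) = 2 * Re (Li2 (of_real s))"
  using norm_Li2_le_of_cmod_le[of "of_real s" s] assms complex_Re_le_cmod[of "Li2 (of_real s)"]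
  by (simp add: dilog_weight_def)

lemma dilog_weight_le_cmod:
  assumes "cmod z \<le> 1"
  shows "dilog_weight z \<le> 33 / 10 * cmod z"
  using dilog_weight_le[OF order_refl assms] Re_Li2_of_real_le[OF norm_ge_zero assms] by linarith

lemma complex_polar:
  obtains w where "cmod w = 1" "z = of_real (cmod z) * w"
    "Re z = cmod z * Re w" "Im z = cmod z * Im w"
proof (cases "z = 0")
  case True
  then show ?thesis using that[of 1] by simp
next
  case False
  then have "z = of_real (cmod z) * sgn z" by (simp add: sgn_div_norm scaleR_conv_of_real)
  then show ?thesis using False that[of "sgn z"] by (simp add: norm_sgn)
qed

text \<open>Here \<open>p\<close>, \<open>q\<close> and \<open>\<beta>\<close> are 0 and
  \<open>\<alpha>\<close> is -1, and the kernel hypothesis reduces to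
  \<open>Re w \<le> v\<close>.\<close>

lemma Re_Li2_nonpos:
  assumes "cmod z \<le> 1" "Re z \<le> 0"
  shows "Re (Li2 z) \<le> 0"
proof (cases "z = 0")
  case True
  then show ?thesis by (simp add: Li2_def)
next
  case False
  obtain w where w: "cmod w = 1" "z = of_real (cmod z) * w" "Re z = cmod z * Re w"
    by (rule complex_polar)
  have "Re w \<le> 0" using w(3) assms(2) False by (simp add: mult_le_0_iff)
  then have "cmod z * (0 + 0 * cmod z / 4) \<le> -1 * Re (Li2 (of_real (cmod z) * w))
     + 0 * Im (Li2 (of_real (cmod z) * w))"
    using assms by (intro Li2_linear_functional_ge w) auto
  then show ?thesis using w(2) by simp
qed

lemma dilog_weight_le_cmod_of_Re_nonpos:
  assumes "cmod z \<le> 1" "Re z \<le> 0"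
  shows "dilog_weight z \<le> 33 / 20 * cmod z"
  using Re_Li2_nonpos[OF assms] norm_Li2_le_of_cmod_le[OF order_refl assms(1)]
    Re_Li2_of_real_le[OF norm_ge_zero assms(1)]
  unfolding dilog_weight_def by linarith

lemma Re_plus_Im_le_dilog_weight: "Re (Li2 z) + Im (Li2 z) \<le> dilog_weight z"
  using abs_Im_le_cmod[of "Li2 z"] by (simp add: dilog_weight_def)

text \<open>The optimal choice of \<open>\<psi>\<close> in \<open>|u| \<ge> Re (cis (-2\<psi>) u)\<close> at argument \<open>3\<pi>/4\<close>
  is close to \<open>arctan 3\<close>.\<close>
lemma Re_plus_3_Im_le_dilog_weight: "(Re (Li2 z) + 3 * Im (Li2 z)) / 5 \<le> dilog_weight z"
proof -
  define x y where "x = Re (Li2 z)" and "y = Im (Li2 z)"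
  \<comment> \<open>Projection onto the unit vector (-4/5, 3/5), which is (cos 2psi, sin 2psi) for
    psi = arctan 3.\<close>
  have "((3 * y - 4 * x) / 5)\<^sup>2 \<le> x\<^sup>2 + y\<^sup>2"
  proof -
    have "x\<^sup>2 + y\<^sup>2 - ((3 * y - 4 * x) / 5)\<^sup>2 = ((3 * x + 4 * y) / 5)\<^sup>2"
      by (simp add: power2_eq_square field_simps)
    then show ?thesis using zero_le_power2[of "(3 * x + 4 * y) / 5"] by linarith
  qed
  then have "(3 * y - 4 * x) / 5 \<le> cmod (Li2 z)"
    unfolding cmod_def x_def y_def by (rule real_le_rsqrt)
  then show ?thesis by (simp add: dilog_weight_def x_def y_def field_simps)
qed

section \<open>Lower bounds for the weight, sector by sector\<close>

text \<open>Conjugation reduces to the upper half plane, and \<open>q \<le> 0\<close> permits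
  replacing the modulus by 1 inside \<open>q * cmod z / 4\<close>. What remains for each sector is a
  polynomial inequality on an arc of the unit circle.\<close>

lemma dilog_weight_ge_of_kernel_ge:
  assumes "0 < cmod z" "cmod z \<le> 1" and q: "q \<le> 0"
    and kernel: "\<And>c s v. c\<^sup>2 + s\<^sup>2 = 1 \<Longrightarrow> 0 \<le> s \<Longrightarrow> 0 \<le> v \<Longrightarrow> v < 1 \<Longrightarrow>
      lo \<le> c \<Longrightarrow> c \<le> hi \<Longrightarrow>
      (p + q * v) * (1 - 2 * v * c + v\<^sup>2) \<le> c - v + \<beta> * s"
    and sector: "lo * cmod z \<le> Re z" "Re z \<le> hi * cmod z"
    and weight: "\<And>u. (Re (Li2 u) + \<beta> * Im (Li2 u)) / K \<le> dilog_weight u" and K: "0 < K"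
  shows "cmod z * ((p + q / 4) / K) \<le> dilog_weight z"
proof -
  have main: "cmod u * ((p + q / 4) / K) \<le> dilog_weight u"
    if u: "cmod u = cmod z" "Re u = Re z" and Im: "0 \<le> Im u" for u
  proof -
    obtain w where w: "cmod w = 1" "u = of_real (cmod u) * w" "Re u = cmod u * Re w" "Im u = cmod u * Im w"
      by (rule complex_polar)
    have ww: "(Re w)\<^sup>2 + (Im w)\<^sup>2 = 1" using w(1) cmod_power2[of w] by simp
    have Imw: "0 \<le> Im w" using Im w(4) u assms(1) by (simp add: zero_le_mult_iff)
    have "lo * cmod z \<le> Re w * cmod z" "Re w * cmod z \<le> hi * cmod z"
      using sector w(3) u by (simp_all add: mult.commute)
    then have Rew: "lo \<le> Re w" "Re w \<le> hi" using assms(1) by auto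
    have "cmod u * (p + q * cmod u / 4) \<le> 1 * Re (Li2 (of_real (cmod u) * w))
       + \<beta> * Im (Li2 (of_real (cmod u) * w))"
      using assms u kernel[OF ww Imw _ _ Rew]
      by (intro Li2_linear_functional_ge w) auto
    then have "cmod u * (p + q * cmod u / 4) \<le> Re (Li2 u) + \<beta> * Im (Li2 u)"
      using w(2) by simp
    moreover have "cmod u * (p + q / 4) \<le> cmod u * (p + q * cmod u / 4)"
      using q assms u mult_left_mono_neg[of "cmod u" 1 q] by (intro mult_left_mono) auto
    ultimately have "cmod u * (p + q / 4) / K \<le> (Re (Li2 u) + \<beta> * Im (Li2 u)) / K"
      using K by (intro divide_right_mono) auto
    then show ?thesis using weight[of u] by simp
  qed
  show ?thesis
  proof (cases "0 \<le> Im z")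
    case True
    then show ?thesis using main[of z] by simp
  next
    case False
    then show ?thesis using main[of "cnj z"] dilog_weight_cnj[of z] assms(2) by simp
  qed
qed

lemma dilog_weight_ge_pi3:
  assumes "0 < cmod z" "cmod z \<le> 1" "cmod z / 2 \<le> Re z"
  shows "5 / 6 * cmod z \<le> dilog_weight z"
proof -
  have "cmod z * ((1 + (- 2 / 3) / 4) / 1) \<le> dilog_weight z"
  proof (rule dilog_weight_ge_of_kernel_ge[where lo = "1/2" and hi = 1 and \<beta> = 1])
    fix c s v :: real
    assume cs: "c\<^sup>2 + s\<^sup>2 = 1" "0 \<le> s" and v: "0 \<le> v" "v < 1" and c: "1/2 \<le> c" "c \<le> 1"
    define P where "P = 1 + - 2 / 3 * v"
    \<comment> \<open>17/10 is slightly below sqrt 3, the absolute slope of the chord of the circle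
      from \<open>c = 1\<close> to \<open>c = 1/2\<close>. With this bound for \<open>s\<close> the
      inequality becomes affine in \<open>c\<close>.\<close>
    have "(17 / 10 * (1 - c))\<^sup>2 \<le> s\<^sup>2"
    proof -
      have "s\<^sup>2 - (17 / 10 * (1 - c))\<^sup>2 = (1 - c) * ((1 + c) - 289 / 100 * (1 - c))"
        using cs(1) by (simp add: power2_eq_square algebra_simps)
      moreover have "\<dots> \<ge> 0" using c by (intro mult_nonneg_nonneg) auto
      ultimately show ?thesis by linarith
    qed
    then have s: "17 / 10 * (1 - c) \<le> s" using cs(2) by (rule power2_le_imp_le)
    \<comment> \<open>\<open>e1\<close> and \<open>e2\<close> are the endpoint cases
      \<open>c = 1\<close> and \<open>c = 1/2\<close>; 27/20 is 1/2 + 17/20. They are then combined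
      with weights \<open>2 * c - 1\<close> and \<open>2 - 2 * c\<close>.\<close>
    have e1: "P * (1 - v)\<^sup>2 \<le> 1 - v"
    proof -
      have "P * (1 - v) \<le> 1 * 1" unfolding P_def using v by (intro mult_mono) auto
      then have "(P * (1 - v)) * (1 - v) \<le> 1 * (1 - v)" using v by (intro mult_right_mono) auto
      then show ?thesis by (simp add: power2_eq_square mult_ac)
    qed
    have e2: "P * (1 - v + v\<^sup>2) \<le> 27 / 20 - v"
    proof -
      have "27 / 20 - v - P * (1 - v + v\<^sup>2) = 1/60 + (1 - v) * (1/3 + v * (1 - 2/3 * v))"
        by (simp add: P_def power2_eq_square field_simps)
      also have "\<dots> \<ge> 0" using v by simp
      finally show ?thesis by simp
    qed
    have "(2 * c - 1) * (P * (1 - v)\<^sup>2) + (2 - 2 * c) * (P * (1 - v + v\<^sup>2))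
       \<le> (2 * c - 1) * (1 - v) + (2 - 2 * c) * (27 / 20 - v)"
      using c e1 e2 by (intro add_mono mult_left_mono) auto
    also have "(2 * c - 1) * (P * (1 - v)\<^sup>2) + (2 - 2 * c) * (P * (1 - v + v\<^sup>2)) = P * (1 - 2 * v * c + v\<^sup>2)"
      by (simp add: power2_eq_square algebra_simps)
    also have "(2 * c - 1) * (1 - v) + (2 - 2 * c) * (27 / 20 - v) = c - v + 17 / 10 * (1 - c)"
      by (simp add: field_simps)
    finally show "(1 + - 2 / 3 * v) * (1 - 2 * v * c + v\<^sup>2) \<le> c - v + 1 * s"
      using s unfolding P_def by linarith
  qed (use assms complex_Re_le_cmod[of z] Re_plus_Im_le_dilog_weight in auto)
  then show ?thesis by simp
qed

lemma dilog_weight_ge_pi2: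
  assumes "0 < cmod z" "cmod z \<le> 1" "0 \<le> Re z"
  shows "11 / 20 * cmod z \<le> dilog_weight z"
proof -
  have "cmod z * ((4/5 + (- 1) / 4) / 1) \<le> dilog_weight z"
  proof (rule dilog_weight_ge_of_kernel_ge[where lo = 0 and hi = 1 and \<beta> = 1])
    fix c s v :: real
    assume cs: "c\<^sup>2 + s\<^sup>2 = 1" "0 \<le> s" and v: "0 \<le> v" "v < 1" and c: "0 \<le> c" "c \<le> 1"
    have "1\<^sup>2 \<le> (c + s)\<^sup>2" using cs c by (simp add: power2_sum)
    then have s: "1 \<le> c + s" by (rule power2_le_imp_le) (use cs c in auto)
    show "(4/5 + - 1 * v) * (1 - 2 * v * c + v\<^sup>2) \<le> c - v + 1 * s"
    \<comment> \<open>The minorant changes sign at 4/5; beyond that point the left side is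
      nonpositive and the right side is at least \<open>1 - v\<close>.\<close>
    proof (cases "v \<le> 4/5")
      case True
      have "v * (4/5 - v) \<le> 4/25"
        using zero_le_power2[of "v - 2/5"] by (simp add: power2_eq_square algebra_simps)
      then have "v * (v * (4/5 - v)) \<le> 1 * (4/25)"
        using v True by (intro mult_mono) auto
      then have "(4/5 - v) * (1 + v\<^sup>2) \<le> 1 - v"
        by (simp add: power2_eq_square algebra_simps)
      moreover have "(4/5 - v) * (1 - 2 * v * c + v\<^sup>2) \<le> (4/5 - v) * (1 + v\<^sup>2)"
        using True v c by (intro mult_left_mono) auto
      ultimately show ?thesis using s by simp
    next
      case False
      have "v * c \<le> v * 1" using v c by (intro mult_left_mono) auto
      then have "0 \<le> (1 - v)\<^sup>2 + 2 * (v - v * c)" by simp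
      then have "0 \<le> 1 - 2 * v * c + v\<^sup>2" by (simp add: power2_eq_square algebra_simps)
      then have "(4/5 + - 1 * v) * (1 - 2 * v * c + v\<^sup>2) \<le> 0"
        using False by (intro mult_nonpos_nonneg) auto
      then show ?thesis using s v by simp
    qed
  qed (use assms complex_Re_le_cmod[of z] Re_plus_Im_le_dilog_weight in auto)
  then show ?thesis by simp
qed

lemma dilog_weight_ge_2pi3:
  assumes "0 < cmod z" "cmod z \<le> 1" "- cmod z / 2 \<le> Re z" "Re z \<le> 0"
  shows "9 / 40 * cmod z \<le> dilog_weight z"
proof -
  have "cmod z * ((3/2 + (- 3/2) / 4) / 5) \<le> dilog_weight z"
  proof (rule dilog_weight_ge_of_kernel_ge[where lo = "-1/2" and hi = 0 and \<beta> = 3])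
    fix c s v :: real
    assume cs: "c\<^sup>2 + s\<^sup>2 = 1" "0 \<le> s" and v: "0 \<le> v" "v < 1" and c: "-1/2 \<le> c" "c \<le> 0"
    have "c\<^sup>2 \<le> (1/2)\<^sup>2" using c by (intro power2_le_iff_abs_le[THEN iffD2]) auto
    then have "(43/50)\<^sup>2 \<le> s\<^sup>2" using cs(1) by (simp add: power2_eq_square)
    then have s: "43/50 \<le> s" using cs(2) by (rule power2_le_imp_le)
    \<comment> \<open>Tangent line to v^3 at 9/20, near the minimiser sqrt 2 / 3 of v^3 - 2v/3. The
      constant 52/25 below is -1/2 + 3 * 43/50, the least value of \<open>c + 3 * s\<close> under
      the two bounds.\<close>
    have "0 \<le> (v - 9/20)\<^sup>2 * (v + 9/10)" using v by simp
    also have "\<dots> = v^3 - 243/400 * v + 729/4000"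
      by (simp add: power2_eq_square power3_eq_cube field_simps)
    finally have "3/2 * (1 - v^3) \<le> 52/25 - v"
      using v by (simp add: field_simps)
    moreover have "3/2 * (1 - v) * (1 - 2 * v * c + v\<^sup>2) \<le> 3/2 * (1 - v) * (1 + v + v\<^sup>2)"
      using v c mult_left_mono[of "-1/2" c v] by (intro mult_left_mono) auto
    moreover have "3/2 * (1 - v) * (1 + v + v\<^sup>2) = 3/2 * (1 - v^3)"
      by (simp add: power2_eq_square power3_eq_cube algebra_simps)
    ultimately have "3/2 * (1 - v) * (1 - 2 * v * c + v\<^sup>2) \<le> c - v + 3 * s"
      using s c by linarith
    moreover have "3/2 + - 3/2 * v = 3/2 * (1 - v)" by simp
    ultimately show "(3/2 + - 3/2 * v) * (1 - 2 * v * c + v\<^sup>2) \<le> c - v + 3 * s"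
      by (simp only:)
  qed (use assms Re_plus_3_Im_le_dilog_weight in auto)
  then show ?thesis by simp
qed

text \<open>The constant \<open>0.71\<close> is a rational stand-in for \<open>- cos (3\<pi>/4)\<close>, rounded up so that
  \<open>Re (z\<^sup>2) \<ge> 0\<close> on the rest of the left half plane.\<close>
lemma dilog_weight_ge_3pi4:
  assumes "0 < cmod z" "cmod z \<le> 1" "- 71 / 100 * cmod z \<le> Re z" "Re z \<le> 0"
  shows "7 / 50 * cmod z \<le> dilog_weight z"
proof -
  have "cmod z * ((1 + (- 6/5) / 4) / 5) \<le> dilog_weight z"
  proof (rule dilog_weight_ge_of_kernel_ge[where lo = "-71/100" and hi = 0 and \<beta> = 3])
    fix c s v :: real
    assume cs: "c\<^sup>2 + s\<^sup>2 = 1" "0 \<le> s" and v: "0 \<le> v" "v < 1" and c: "-71/100 \<le> c" "c \<le> 0"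
    have "c\<^sup>2 \<le> (71/100)\<^sup>2" using c by (intro power2_le_iff_abs_le[THEN iffD2]) auto
    then have "(7/10)\<^sup>2 \<le> s\<^sup>2" using cs(1) by (simp add: power2_eq_square)
    then have s: "7/10 \<le> s" using cs(2) by (rule power2_le_imp_le)
    have vc: "v * c \<le> 0" "- (71/100) * v \<le> v * c"
      using v c mult_left_mono[of "-71/100" c v] by (auto simp: mult_nonneg_nonpos)
    show "(1 + - 6/5 * v) * (1 - 2 * v * c + v\<^sup>2) \<le> c - v + 3 * s"
    proof (cases "v \<le> 5/6")
      case True
      \<comment> \<open>The worst values \<open>c = -71/100\<close> and \<open>s = 7/10\<close> give
        139/100 on the right and 71/50 in the quadratic; the cubic difference is expanded around
        2/5.\<close>
      have "139/100 - v - (1 - 6/5 * v) * (1 + 71/50 * v + v\<^sup>2)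
        = 6/5 * ((v - 2/5)\<^sup>2 * (v + 4/5)) + 88/125 * (v - 2/5)\<^sup>2 + 1547/12500 - 101/1250 * v"
        by (simp add: power2_eq_square power3_eq_cube field_simps)
      moreover have "0 \<le> (v - 2/5)\<^sup>2 * (v + 4/5)" "0 \<le> (v - 2/5)\<^sup>2" using v by simp_all
      ultimately have "(1 - 6/5 * v) * (1 + 71/50 * v + v\<^sup>2) \<le> 139/100 - v"
        using v by linarith
      moreover have "(1 - 6/5 * v) * (1 - 2 * v * c + v\<^sup>2) \<le> (1 - 6/5 * v) * (1 + 71/50 * v + v\<^sup>2)"
        using True vc by (intro mult_left_mono) auto
      ultimately show ?thesis using s c by simp
    next
      case False
      have "(1 + - 6/5 * v) * (1 - 2 * v * c + v\<^sup>2) \<le> 0"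
        using False vc by (intro mult_nonpos_nonneg add_nonneg_nonneg) auto
      then show ?thesis using s v c by simp
    qed
  qed (use assms Re_plus_3_Im_le_dilog_weight in auto)
  then show ?thesis by simp
qed

section \<open>Comparison of root dilogarithms\<close>

lemma root_dilog_le_iff:
  "root_dilog k z \<le> root_dilog j w \<longleftrightarrow>
    dilog_weight (z ^ k) / real k ^ 2 \<le> dilog_weight (w ^ j) / real j ^ 2"
proof -
  have "dilog_weight u / (2 * real n ^ 2) = (1 / 2) * (dilog_weight u / real n ^ 2)" for u n
    by simp
  then show ?thesis
    unfolding root_dilog_eq real_sqrt_le_iff
    by (simp only: mult_le_cancel_left_pos[of "1 / 2"] half_gt_zero_iff zero_less_one)
qed

lemma root_dilog_less_iff:
  "root_dilog k z < root_dilog j w \<longleftrightarrow>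
    dilog_weight (z ^ k) / real k ^ 2 < dilog_weight (w ^ j) / real j ^ 2"
  using root_dilog_le_iff[of j w k z] by (simp add: not_le[symmetric])

text \<open>Both the power and the denominator improve as \<open>k\<close> grows, so one estimate at
  \<open>m\<close> serves all larger exponents.\<close>

lemma dilog_weight_power_le:
  assumes "cmod z \<le> 1" "m \<le> k" "0 < m"
  shows "dilog_weight (z ^ k) / real k ^ 2 \<le> 33 / 10 * cmod z ^ m / real m ^ 2"
proof -
  have "cmod z ^ k \<le> 1" using assms(1) by (simp add: power_le_one)
  then have "dilog_weight (z ^ k) \<le> 33 / 10 * cmod z ^ k"
    using dilog_weight_le_cmod[of "z ^ k"] by (simp add: norm_power)
  also have "\<dots> \<le> 33 / 10 * cmod z ^ m"
    using assms by (intro mult_left_mono power_decreasing) auto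
  finally show ?thesis
    using assms by (intro frac_le power_mono) auto
qed

lemma root_dilog_le_cmod:
  assumes "cmod z \<le> 1"
  shows "root_dilog k z \<le> root_dilog k (of_real (cmod z))"
proof -
  have r: "0 \<le> cmod z ^ k" "cmod z ^ k \<le> 1" using assms(1) by (auto simp: power_le_one)
  have "dilog_weight (z ^ k) \<le> dilog_weight (of_real (cmod z) ^ k)"
    using dilog_weight_le[of "z ^ k" "cmod z ^ k"] dilog_weight_of_real[OF r] r
    by (simp add: norm_power)
  then show ?thesis
    using assms by (simp add: root_dilog_le_iff divide_right_mono)
qed

lemma root_dilog_of_real_antimono:
  assumes "0 \<le> r" "r \<le> 1" "0 < m" "m \<le> k"
  shows "root_dilog k (of_real r) \<le> root_dilog m (of_real r)"
proof -
  have r: "0 \<le> r ^ m" "r ^ m \<le> 1" "r ^ k \<le> r ^ m"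
    using assms by (auto simp: power_le_one power_decreasing)
  have "dilog_weight (of_real r ^ k) \<le> dilog_weight (of_real r ^ m)"
    using dilog_weight_le[of "of_real r ^ k" "r ^ m"] dilog_weight_of_real[OF r(1,2)] r assms
    by (simp add: norm_power)
  then have "dilog_weight (of_real r ^ k) / real k ^ 2 \<le> dilog_weight (of_real r ^ m) / real m ^ 2"
    using assms dilog_weight_nonneg by (intro frac_le power_mono) auto
  then show ?thesis using assms by (simp add: root_dilog_le_iff)
qed

lemma Re_power2_eq: "Re (z ^ 2) = 2 * (Re z)\<^sup>2 - (cmod z)\<^sup>2"
  by (simp add: cmod_power2 Re_power2)

lemma root_dilog_2_cmod_less_1:
  assumes "0 < cmod z" "cmod z \<le> 1" "cmod z / 2 \<le> Re z"
  shows "root_dilog 2 (of_real (cmod z)) < root_dilog 1 z"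
proof -
  have "dilog_weight (of_real (cmod z) ^ 2) \<le> 33 / 10 * cmod z ^ 2"
    using dilog_weight_le_cmod[of "of_real (cmod z) ^ 2"] assms by (simp add: norm_power power_le_one)
  also have "\<dots> \<le> 33 / 10 * cmod z ^ 1"
    using assms by (intro mult_left_mono power_decreasing) auto
  \<comment> \<open>A narrow margin: 4 * 5/6 = 10/3 against 33/10.\<close>
  also have "\<dots> < 4 * dilog_weight z"
    using dilog_weight_ge_pi3[OF assms] assms(1) unfolding power_one_right by linarith
  finally show ?thesis by (subst root_dilog_less_iff) auto
qed

lemma root_dilog_cmod_less_1:
  assumes "0 < cmod z" "cmod z \<le> 1" "0 \<le> Re z" "3 \<le> k"
  shows "root_dilog k (of_real (cmod z)) < root_dilog 1 z"
proof -
  have "dilog_weight (of_real (cmod z) ^ k) / real k ^ 2 \<le> 33 / 10 * cmod z ^ 3 / real 3 ^ 2"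
    using dilog_weight_power_le[of "of_real (cmod z)" 3 k] assms by simp
  also have "\<dots> \<le> 33 / 10 * cmod z ^ 1 / real 3 ^ 2"
    using assms by (intro divide_right_mono mult_left_mono power_decreasing) auto
  also have "\<dots> < dilog_weight (z ^ 1) / real 1 ^ 2"
    using dilog_weight_ge_pi2[OF assms(1-3)] assms(1) by (simp del: zero_less_norm_iff)
  finally show ?thesis
    using assms by (subst root_dilog_less_iff) auto
qed

text \<open>Past pi/3 the square of \<open>z\<close> lies in the left half plane, so the halved
  upper bound 33/20 meets the weaker lower bound 4 * 11/20.\<close>

lemma root_dilog_2_less_1:
  assumes "0 < cmod z" "cmod z \<le> 1" "0 \<le> Re z"
  shows "root_dilog 2 z < root_dilog 1 z"
proof (cases "cmod z / 2 \<le> Re z")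
  case True
  then show ?thesis
    using root_dilog_2_cmod_less_1 root_dilog_le_cmod[of z 2] assms by fastforce
next
  case False
  have "(Re z)\<^sup>2 \<le> (cmod z / 2)\<^sup>2" using False assms by (intro power_mono) auto
  moreover have "(cmod z / 2)\<^sup>2 = (cmod z)\<^sup>2 / 4" by (simp add: power_divide)
  ultimately have "Re (z ^ 2) \<le> 0"
    unfolding Re_power2_eq using zero_le_power2[of "cmod z"] by linarith
  then have "dilog_weight (z ^ 2) \<le> 33 / 20 * cmod z ^ 2"
    using dilog_weight_le_cmod_of_Re_nonpos[of "z ^ 2"] assms by (simp add: norm_power power_le_one)
  also have "\<dots> \<le> 33 / 20 * cmod z ^ 1"
    using assms by (intro mult_left_mono power_decreasing) auto
  also have "\<dots> < 4 * dilog_weight z"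
    using dilog_weight_ge_pi2[OF assms] assms(1) unfolding power_one_right by linarith
  finally show ?thesis by (subst root_dilog_less_iff) auto
qed

lemma root_dilog_less_1_or_2:
  assumes z: "0 < cmod z" "cmod z \<le> 1" and Re: "Re z \<le> 0" and k: "4 \<le> k"
  shows "root_dilog k z < root_dilog 1 z \<or> root_dilog k z < root_dilog 2 z"
proof -
  define r where "r = cmod z"
  have r: "0 < r" "r \<le> 1" using z by (auto simp: r_def)
  have r4: "r ^ 4 \<le> r" "r ^ 4 \<le> r ^ 2"
    using power_decreasing[of 1 4 r] power_decreasing[of 2 4 r] r by auto
  have k4: "dilog_weight (z ^ k) / real k ^ 2 \<le> 33 / 160 * r ^ 4"
    using dilog_weight_power_le[of z 4 k] z k by (simp add: r_def)
  \<comment> \<open>33/250 is the general bound at exponent 5; at exponent 4 the halved constant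
    gives 33/320, which is smaller.\<close>
  have k5: "dilog_weight (z ^ k) / real k ^ 2 \<le> 33 / 250 * r ^ 4" if "Re (z ^ 4) \<le> 0"
  proof (cases "k = 4")
    case True
    have "dilog_weight (z ^ 4) \<le> 33 / 20 * r ^ 4"
      using dilog_weight_le_cmod_of_Re_nonpos[of "z ^ 4"] that z
      by (simp add: norm_power power_le_one r_def)
    moreover have "0 \<le> r ^ 4" using r by simp
    ultimately have "dilog_weight (z ^ 4) / 16 \<le> 33 / 250 * r ^ 4" by linarith
    then show ?thesis by (simp add: True)
  next
    case False
    have "dilog_weight (z ^ k) / real k ^ 2 \<le> 33 / 250 * r ^ 5"
      using dilog_weight_power_le[of z 5 k] z k False by (simp add: r_def)
    also have "\<dots> \<le> 33 / 250 * r ^ 4"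
      using r by (intro mult_left_mono power_decreasing) auto
    finally show ?thesis .
  qed
  have Re4: "Re (z ^ 4) = 2 * (Re (z ^ 2))\<^sup>2 - (r ^ 2)\<^sup>2"
    using Re_power2_eq[of "z ^ 2"] by (simp add: norm_power r_def flip: power_mult)
  have r2: "0 < r ^ 2" "r ^ 2 \<le> 1" using r by (auto simp: power_le_one)
  have Re4_nonpos: "Re (z ^ 4) \<le> 0" if "\<bar>Re (z ^ 2)\<bar> \<le> r ^ 2 / 2"
  proof -
    have "(Re (z ^ 2))\<^sup>2 \<le> (r ^ 2 / 2)\<^sup>2"
      using that r by (intro power2_le_iff_abs_le[THEN iffD2]) auto
    moreover have "(r ^ 2 / 2)\<^sup>2 = (r ^ 2)\<^sup>2 / 4" by (simp add: power_divide)
    ultimately show ?thesis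
      unfolding Re4 using zero_le_power2[of "r ^ 2"] by linarith
  qed
  have Re2: "Re (z ^ 2) = 2 * (Re z)\<^sup>2 - r ^ 2" by (simp add: Re_power2_eq r_def)
  have less1: "root_dilog k z < root_dilog 1 z"
    if "dilog_weight (z ^ k) / real k ^ 2 < dilog_weight z"
    using that k by (subst root_dilog_less_iff) auto
  have less2: "root_dilog k z < root_dilog 2 z"
    if "dilog_weight (z ^ k) / real k ^ 2 < dilog_weight (z ^ 2) / 4"
    using that k by (subst root_dilog_less_iff) auto
  \<comment> \<open>The cuts are at argument 2pi/3, slightly past 3pi/4, and 5pi/6. The constants to
    compare are 33/160 < 9/40, 33/250 < 7/50, 33/250 < 11/80 and 33/160 < 5/24.\<close>
  consider "- r / 2 \<le> Re z" | "- 71 / 100 * r \<le> Re z" "Re z < - r / 2"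
    | "Re z < - 71 / 100 * r" "Re (z ^ 2) \<le> r ^ 2 / 2" | "r ^ 2 / 2 \<le> Re (z ^ 2)"
    by linarith
  then show ?thesis
  proof cases
    case 1
    then have "9 / 40 * r \<le> dilog_weight z"
      using dilog_weight_ge_2pi3[of z] z Re by (simp add: r_def)
    then have "dilog_weight (z ^ k) / real k ^ 2 < dilog_weight z"
      using k4 r4(1) r by linarith
    then show ?thesis using less1 by blast
  next
    case 2
    have "(- Re z)\<^sup>2 \<le> (71 / 100 * r)\<^sup>2" using 2 Re by (intro power_mono) auto
    moreover have "(r / 2)\<^sup>2 \<le> (- Re z)\<^sup>2" using 2 r by (intro power_mono) auto
    moreover have "(71 / 100 * r)\<^sup>2 = 5041 / 10000 * r ^ 2" "(r / 2)\<^sup>2 = r ^ 2 / 4"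
      by (simp_all add: power_mult_distrib power_divide)
    ultimately have "\<bar>Re (z ^ 2)\<bar> \<le> r ^ 2 / 2"
      unfolding Re2 power2_minus using r2(1) by linarith
    then have "dilog_weight (z ^ k) / real k ^ 2 \<le> 33 / 250 * r ^ 4"
      using k5 Re4_nonpos by blast
    moreover have "7 / 50 * r \<le> dilog_weight z"
      using dilog_weight_ge_3pi4[of z] z Re 2 by (simp add: r_def)
    ultimately have "dilog_weight (z ^ k) / real k ^ 2 < dilog_weight z"
      using r4(1) r by linarith
    then show ?thesis using less1 by blast
  next
    case 3
    have "(71 / 100 * r)\<^sup>2 \<le> (- Re z)\<^sup>2" using 3 r by (intro power_mono) auto
    moreover have "(71 / 100 * r)\<^sup>2 = 5041 / 10000 * r ^ 2"
      by (simp add: power_mult_distrib power_divide)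
    ultimately have Re2_nonneg: "0 \<le> Re (z ^ 2)"
      unfolding Re2 power2_minus using r2(1) by linarith
    then have "dilog_weight (z ^ k) / real k ^ 2 \<le> 33 / 250 * r ^ 4"
      using k5 Re4_nonpos 3 by simp
    moreover have "11 / 20 * r ^ 2 \<le> dilog_weight (z ^ 2)"
      using dilog_weight_ge_pi2[of "z ^ 2"] Re2_nonneg r2 by (simp add: norm_power r_def)
    ultimately have "dilog_weight (z ^ k) / real k ^ 2 < dilog_weight (z ^ 2) / 4"
      using r4(2) r2 by linarith
    then show ?thesis using less2 by blast
  next
    case 4
    then have "5 / 6 * r ^ 2 \<le> dilog_weight (z ^ 2)"
      using dilog_weight_ge_pi3[of "z ^ 2"] r2 by (simp add: norm_power r_def)
    then have "dilog_weight (z ^ k) / real k ^ 2 < dilog_weight (z ^ 2) / 4"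
      using k4 r4(2) r2 by linarith
    then show ?thesis using less2 by blast
  qed
qed

section \<open>From sectors in the argument to bounds on the real part\<close>

theorem mainTheorem6:
  fixes z :: complex
  assumes "0 < cmod z" and "cmod z \<le> 1"
  shows "(\<bar>Arg z\<bar> \<le> pi / 3 \<longrightarrow>
            (\<forall>k\<ge>2. root_dilog k z \<le> root_dilog k (of_real (cmod z)) \<and>
                   root_dilog k (of_real (cmod z)) \<le> root_dilog 2 (of_real (cmod z)) \<and>
                   root_dilog 2 (of_real (cmod z)) < root_dilog 1 z)) \<and>
         (\<bar>Arg z\<bar> \<le> pi / 2 \<longrightarrow>
            (\<forall>k\<ge>3. root_dilog k z \<le> root_dilog k (of_real (cmod z)) \<and>
                   root_dilog k (of_real (cmod z)) < root_dilog 1 z)) \<and>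
         (0 \<le> Arg z \<and> Arg z \<le> pi / 2 \<longrightarrow>
            (\<forall>k\<ge>2. root_dilog k z < root_dilog 1 z)) \<and>
         (pi / 2 \<le> Arg z \<and> Arg z \<le> pi \<longrightarrow>
            (\<forall>k\<ge>4. root_dilog k z < Max {root_dilog 1 z, root_dilog 2 z, root_dilog 3 z}))"
proof -
  \<comment> \<open>Cosine is even and decreasing on [0, pi], so each range of \<open>Arg z\<close>
    becomes a linear condition on \<open>Re z\<close>.\<close>
  have Re: "Re z = cmod z * cos \<bar>Arg z\<bar>"
    using assms(1) by (simp add: cos_Arg)
  have pi3: "cmod z / 2 \<le> Re z" if "\<bar>Arg z\<bar> \<le> pi / 3"
  proof -
    have "cos (pi / 3) \<le> cos \<bar>Arg z\<bar>" using that by (intro cos_monotone_0_pi_le) auto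
    then show ?thesis
      unfolding Re using mult_left_mono[of "1 / 2" "cos \<bar>Arg z\<bar>" "cmod z"] by (simp add: cos_60)
  qed
  have pi2: "0 \<le> Re z" if "\<bar>Arg z\<bar> \<le> pi / 2"
  proof -
    have "cos (pi / 2) \<le> cos \<bar>Arg z\<bar>" using that by (intro cos_monotone_0_pi_le) auto
    then show ?thesis unfolding Re by simp
  qed
  have pi: "Re z \<le> 0" if "pi / 2 \<le> Arg z" "Arg z \<le> pi"
  proof -
    have "cos \<bar>Arg z\<bar> \<le> cos (pi / 2)" using that pi_gt_zero by (intro cos_monotone_0_pi_le) auto
    then show ?thesis unfolding Re by (simp add: mult_nonneg_nonpos)
  qed
  have mono: "root_dilog k z \<le> root_dilog k (of_real (cmod z))" for k
    using root_dilog_le_cmod assms by blast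
  have part2: "root_dilog k (of_real (cmod z)) < root_dilog 1 z" if "0 \<le> Re z" "3 \<le> k" for k
    using root_dilog_cmod_less_1 assms that by blast
  have part3: "root_dilog k z < root_dilog 1 z" if "0 \<le> Re z" "2 \<le> k" for k
  proof (cases "k = 2")
    case True
    then show ?thesis using root_dilog_2_less_1 assms that by blast
  next
    case False
    then show ?thesis using part2[of k] mono[of k] that by simp
  qed
  show ?thesis
  proof (intro conjI impI allI)
    fix k :: nat
    assume *: "\<bar>Arg z\<bar> \<le> pi / 3" "2 \<le> k"
    show "root_dilog k z \<le> root_dilog k (of_real (cmod z))" using mono * by simp
    show "root_dilog k (of_real (cmod z)) \<le> root_dilog 2 (of_real (cmod z))"
      using root_dilog_of_real_antimono assms * by simp
    show "root_dilog 2 (of_real (cmod z)) < root_dilog 1 z"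
      using root_dilog_2_cmod_less_1 assms pi3 * by blast
  next
    fix k :: nat
    assume *: "\<bar>Arg z\<bar> \<le> pi / 2" "3 \<le> k"
    show "root_dilog k z \<le> root_dilog k (of_real (cmod z))" using mono * by simp
    show "root_dilog k (of_real (cmod z)) < root_dilog 1 z" using part2 pi2 * by blast
  next
    fix k :: nat
    assume "0 \<le> Arg z \<and> Arg z \<le> pi / 2" "2 \<le> k"
    then show "root_dilog k z < root_dilog 1 z" using part3 pi2 by simp
  next
    fix k :: nat
    assume "pi / 2 \<le> Arg z \<and> Arg z \<le> pi" "4 \<le> k"
    then have "root_dilog k z < root_dilog 1 z \<or> root_dilog k z < root_dilog 2 z"
      using root_dilog_less_1_or_2 assms pi by blast
    then show "root_dilog k z < Max {root_dilog 1 z, root_dilog 2 z, root_dilog 3 z}"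
      by (auto simp: less_max_iff_disj)
  qed
qed

end
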